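(* Let $U\subset\mathbb{C}$ be an open subset, let $i\in\{0,1\}$ and $n\in\mathbb{N}$, and let $X\subset U$ be a Polish space (with the subspace topology) having characteristic system $(i,n)$. Let $f:U\to\mathbb{C}$ be a function that is continuous in $U$ and analytic in $U\setminus X$. Then the complex line integral of $f$ along the boundary of any triangle in $U$ vanishes, i.e. \[ \int_{[z_1,z_2,z_3,z_1]} f(z)\,dz = 0 \] for every triangle $\triangle(z_1,z_2,z_3)\subset U$.
   Context: A Polish space is a separable completely metrizable topological space. For a Polish space $X$, its Cantor-Bendixson derivative is $X'=\{x\in X : x \text{ is a limit point of } X\}$; set $X^{0}=X$ and $X^{k}=(X^{k-1})'$ for $k\geq 1$. A countable Polish space $X$ has characteristic system $(k,n)$, with $n$ a natural number, if $X^{k}\neq\emptyset$, $X^{k+1}=\emptyset$ and the cardinality of $X^{k}$ is $n$. (Having a characteristic system includes being countable.) Here $\triangle(z_1,z_2,z_3)$ denotes the closed (filled) triangle with non-collinear vertices $z_1,z_2,z_3\in\mathbb{C}$, and $[z_1,z_2,z_3,z_1]$ is the closed polygonal curve running along straight segments from $z_1$ to $z_2$ to $z_3$ to $z_1$, parametrizing the boundary of the triangle. *)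

theory Defs
  imports "HOL-Complex_Analysis.Complex_Analysis"
begin

definition Polish_space :: "'a topology \<Rightarrow> bool" where
  "Polish_space T \<longleftrightarrow> separable_space T \<and> completely_metrizable_space T"

text \<open>The derivative is again a topological space (with the subspace topology), so that iterating it
  takes, at every stage, the limit points of the previous stage within that stage.\<close>

definition cb_derivative :: "'a topology \<Rightarrow> 'a topology" where
  "cb_derivative T = subtopology T (T derived_set_of (topspace T))"

text \<open>Finiteness is stated explicitly because \<^term>\<open>card\<close> is 0 on infinite sets.\<close>

definition has_characteristic_system :: "'a topology \<Rightarrow> nat \<Rightarrow> nat \<Rightarrow> bool" where
  "has_characteristic_system T k n \<longleftrightarrow>
     Polish_space T \<and> countable (topspace T) \<and>
     topspace ((cb_derivative ^^ k) T) \<noteq> {} \<and>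
     topspace ((cb_derivative ^^ (k + 1)) T) = {} \<and>
     finite (topspace ((cb_derivative ^^ k) T)) \<and>
     card (topspace ((cb_derivative ^^ k) T)) = n"

end

theory Submission
  imports Defs
begin

text \<open>
  Let \<open>S\<close> be the set of points of \<open>U\<close> at which \<open>f\<close> is not analytic; it is contained in \<open>X\<close>.
  Since the iterated derivatives of \<open>X\<close> reach the empty set, a nonempty \<open>S\<close> would have an isolated
  point \<open>p\<close>: any point of \<open>S\<close> lost at the first derivative of \<open>X\<close> that does not contain \<open>S\<close>.
  Near \<open>p\<close> the function is continuous and holomorphic off \<open>p\<close>, so the singularity is removable and
  \<open>f\<close> is analytic at \<open>p\<close>, a contradiction. Hence \<open>f\<close> is holomorphic on \<open>U\<close> and Cauchy's theorem
  for triangles applies.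
\<close>

text \<open>Turns the iteration on topologies into one on sets: each stage is again a
  \<open>top_of_set\<close>, so an induction can generalize over the set alone.\<close>

lemma cb_derivative_top_of_set:
  "cb_derivative (top_of_set Y) = top_of_set {x \<in> Y. x islimpt Y}"
proof -
  have "euclidean derived_set_of Y = {x. x islimpt Y}"
    by (simp add: derived_set_of_def islimpt_def Bex_def conj_ac flip: imp_conjL)
  then have "top_of_set Y derived_set_of Y = {x \<in> Y. x islimpt Y}"
    by (simp add: derived_set_of_subtopology Collect_conj_eq)
  moreover have "Y \<inter> {x \<in> Y. x islimpt Y} = {x \<in> Y. x islimpt Y}"
    by blast
  ultimately show ?thesis
    by (simp only: cb_derivative_def subtopology_subtopology topspace_euclidean_subtopology)
qed

lemma cb_derivative_empty_imp_isolated: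
  assumes "topspace ((cb_derivative ^^ k) (top_of_set X)) = {}"
    and "S \<subseteq> X" and "S \<noteq> {}"
  shows "\<exists>p\<in>S. \<not> p islimpt S"
  using assms
proof (induction k arbitrary: X)
  case 0
  then show ?case by simp
next
  case (Suc k)
  show ?case
  proof (cases "S \<subseteq> {x \<in> X. x islimpt X}")
    \<comment> \<open>\<open>S\<close> survives the first derivative, so the induction hypothesis
      applies to the derived set with the same \<open>S\<close>.\<close>
    case True
    moreover have "topspace ((cb_derivative ^^ k) (top_of_set {x \<in> X. x islimpt X})) = {}"
      using Suc.prems(1) by (simp only: funpow_Suc_right o_apply cb_derivative_top_of_set)
    ultimately show ?thesis
      using Suc.IH \<open>S \<noteq> {}\<close> by blast
  next
    \<comment> \<open>A point of \<open>S\<close> that is no limit point of \<open>X\<close> is none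
      of its subset \<open>S\<close> either.\<close>
    case False
    with \<open>S \<subseteq> X\<close> show ?thesis
      using islimpt_subset by blast
  qed
qed

lemma analytic_at_isolated_singularity:
  assumes "open U" and "p \<in> U" and "continuous_on U f"
    and "\<not> p islimpt {z \<in> U. \<not> f analytic_on {z}}"
  shows "f analytic_on {p}"
proof -
  obtain T where "p \<in> T" "open T"
    and T: "\<forall>z\<in>{z \<in> U. \<not> f analytic_on {z}}. z \<in> T \<longrightarrow> z = p"
    using assms(4) unfolding islimpt_def by blast
  have "\<forall>z\<in>T \<inter> U - {p}. f analytic_on {z}"
    using T by blast
  then have "f analytic_on (T \<inter> U - {p})"
    by (rule iffD2[OF analytic_on_analytic_at])
  then have "f holomorphic_on (T \<inter> U - {p})"
    by (rule analytic_imp_holomorphic)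
  moreover have "continuous_on (T \<inter> U) f"
    using assms(3) by (rule continuous_on_subset) simp
  moreover have "open (T \<inter> U)"
    using \<open>open T\<close> assms(1) by (rule open_Int)
  ultimately have "f holomorphic_on (T \<inter> U)"
    by (intro no_isolated_singularity[of "T \<inter> U" f "{p}"]) simp_all
  with \<open>open (T \<inter> U)\<close> \<open>p \<in> T\<close> assms(2) show ?thesis
    unfolding analytic_at by blast
qed

theorem corollary1p4:
  fixes U X :: "complex set" and f :: "complex \<Rightarrow> complex" and i n :: nat
    and z1 z2 z3 :: complex
  assumes "open U"
    and "i \<in> {0, 1}"
    and "X \<subseteq> U"
    and "has_characteristic_system (top_of_set X) i n"
    and "continuous_on U f"
    and "f analytic_on (U - X)"
    and "\<not> collinear {z1, z2, z3}"
    and "convex hull {z1, z2, z3} \<subseteq> U"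
  shows "(f has_contour_integral 0) (linepath z1 z2 +++ linepath z2 z3 +++ linepath z3 z1)"
proof -
  \<comment> \<open>An isolated point of \<open>S\<close> may still be a limit point of
    \<open>X\<close>, but \<open>f\<close> is analytic at all other points near it.\<close>
  define S where "S = {z \<in> U. \<not> f analytic_on {z}}"
  have sub: "S \<subseteq> X"
  proof
    fix z assume "z \<in> S"
    then have "z \<in> U" "\<not> f analytic_on {z}"
      by (simp_all add: S_def)
    moreover have "f analytic_on {z}" if "z \<in> U - X"
      using assms(6) by (rule analytic_on_subset) (use that in simp)
    ultimately show "z \<in> X"
      by blast
  qed
  have empty: "topspace ((cb_derivative ^^ (i + 1)) (top_of_set X)) = {}"
    using assms(4) by (simp only: has_characteristic_system_def)
  have "S = {}"
  proof (rule ccontr)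
    assume "S \<noteq> {}"
    with cb_derivative_empty_imp_isolated[OF empty sub]
    obtain p where "p \<in> S" "\<not> p islimpt S"
      by blast
    then show False
      using analytic_at_isolated_singularity[OF assms(1) _ assms(5), of p]
      by (simp add: S_def)
  qed
  then have "\<forall>z\<in>U. f analytic_on {z}"
    by (simp add: S_def)
  then have "f analytic_on U"
    by (rule iffD2[OF analytic_on_analytic_at])
  then have "f holomorphic_on convex hull {z1, z2, z3}"
    using assms(8) by (rule analytic_imp_holomorphic[OF analytic_on_subset])
  then show ?thesis
    by (rule Cauchy_theorem_triangle)
qed

end
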